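(* Let $m$ and $n\ge 4$ be even, and let $(G,H)\in\mathcal{A}^{(1)}(m,n)\times\mathcal{A}^{(2)}(m,n)$. Let $(x_1\;x_2\;\dots\;x_n)$ be a row of $G$ such that $(x_1\;-x_2\;x_3\;\dots\;x_{n-1}\;-x_n)$ (signs alternating) is also a row of $G$, and let $T=\left[\begin{array}{c}C\\ D\end{array}\right]=[\,T^{[1]}\;T^{[2]}\,]$ be a $T$-submatrix of $H$. Let $\mathbb{X}=\{\mathcal{X}^{(1)},\dots,\mathcal{X}^{(\frac n2-2)}\}$ be a complete tensor set of LSESC of order $\frac n2-1$, let $\mathbf{X}^{(s)}_k$ be the $k$-th frontal slice of $\mathcal{X}^{(s)}$, and put $\mathbf{Y}^{(s)}_k=I_2\otimes\mathbf{X}^{(s)}_k$ for $1\le s\le \frac n2-2$, $1\le k\le\frac n2-1$. Let $G'$ be the matrix obtained from $G$ by deleting the two rows $(x_1\;x_2\;\dots\;x_n)$ and $(x_1\;-x_2\;\dots\;x_{n-1}\;-x_n)$, let $B_0=G'\otimes\mathbf{J}_{\frac n2-1}$, and let $$B=\left[\begin{array}{c|cccc} E_1(x_1,x_2)&T_{x_3,x_4}&T_{x_5,x_6}&\cdots&T_{x_{n-1},x_n}\\ E_2(x_1,x_2)&\mathbf{Y}^{(1)}_{1}T_{x_3,x_4}&\mathbf{Y}^{(1)}_{2}T_{x_5,x_6}&\cdots&\mathbf{Y}^{(1)}_{\frac n2-1}T_{x_{n-1},x_n}\\ E_3(x_1,x_2)&\mathbf{Y}^{(2)}_{1}T_{x_3,x_4}&\mathbf{Y}^{(2)}_{2}T_{x_5,x_6}&\cdots&\mathbf{Y}^{(2)}_{\frac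 n2-1}T_{x_{n-1},x_n}\\ \vdots&\vdots&\vdots&&\vdots\\ E_{\frac n2-1}(x_1,x_2)&\mathbf{Y}^{(\frac n2-2)}_{1}T_{x_3,x_4}&\mathbf{Y}^{(\frac n2-2)}_{2}T_{x_5,x_6}&\cdots&\mathbf{Y}^{(\frac n2-2)}_{\frac n2-1}T_{x_{n-1},x_n} \end{array}\right],$$ where $$E_i(x_1,x_2)=\left[\begin{array}{c} \mathbf{J}_{\frac n2-1}^{\top}\otimes[\,x_1\mathbf{c}^{[1]}_i\;\;x_2\mathbf{c}^{[2]}_i\,]\\ \mathbf{J}_{\frac n2-1}^{\top}\otimes[\,x_1\mathbf{d}^{[1]}_i\;\;x_2\mathbf{d}^{[2]}_i\,] \end{array}\right],\qquad T_{x_d,x_{d+1}}=[\,x_dT^{[1]}\;\;x_{d+1}T^{[2]}\,].$$ Then the matrix $$\Psi_{\mathbb{X}}(G,H)=\left[\begin{array}{c}B_0\\ B\end{array}\right]$$ is a $BH(m,(\frac n2-1)n)$.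
   Context: A Butson matrix $BH(m,n)$ is an $n\times n$ matrix $M$ whose entries are complex $m$-th roots of unity and which satisfies $MM^*=nI_n$, where $M^*$ is the conjugate transpose. It is normalized if its first row and first column consist entirely of ones. $\mathcal{BH}(m,n)$ is the set of all normalized $BH(m,n)$ matrices. $\mathbf{J}_k$ is the $1\times k$ row vector of all ones. The Kronecker product of $X=(x_{ij})$ and $Y$ is $X\otimes Y=(x_{ij}Y)$. For even $m,n$: $\mathcal{A}^{(1)}(m,n)$ is the set of $M\in\mathcal{BH}(m,n)$ that have a row $(x_1\;x_2\;\dots\;x_n)$ such that $(x_1\;-x_2\;x_3\;\dots\;x_{n-1}\;-x_n)$ is also a row of $M$. $\mathcal{A}^{(2)}(m,n)$ is the set of $M\in\mathcal{BH}(m,n)$ that have a row and a column, both with all entries in $\{1,-1\}$, whose common entry is $-1$. $T$-submatrix: for $H\in\mathcal{A}^{(2)}(m,n)$, the rows and columns of $H$ can be permuted (moving to second position a row and a column of $H$, both with all entries in $\{1,-1\}$, whose common entry is $-1$, and then sorting) so as to obtain a matrix whose first row and first column are all ones, and whose second row and second column both are $(1,-1,1,\dots,1,-1,\dots,-1)$ with, after the first two entries, $\frac{n-2}2$ entries $1$ followed by $\frac{n-2}2$ entries $-1$. Any $(n-2)\times(n-2)$ matrix $T$ obtained by deleting the first two rows and the first two columns of such a rearranged matrix is called a $T$-submatrix of $H$. Write $T=\left[\begin{array}{c}C\\ D\end{array}\right]$ with $C,D$ of size $\frac{n-2}2\times(n-2)$ (top and bottom halves), and $T=[\,T^{[1]}\;T^{[2]}\,]$,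 $C=[\,C^{[1]}\;C^{[2]}\,]$, $D=[\,D^{[1]}\;D^{[2]}\,]$, where the superscript $[1]$ denotes the first $\frac n2-1$ columns and $[2]$ the remaining $\frac n2-1$ columns. $\mathbf{c}^{[1]}_i,\mathbf{c}^{[2]}_i,\mathbf{d}^{[1]}_i,\mathbf{d}^{[2]}_i$ denote the $i$-th rows of $C^{[1]},C^{[2]},D^{[1]},D^{[2]}$. A Latin square of order $k$ is a $k\times k$ matrix with entries in $\{1,\dots,k\}$ in which each symbol appears exactly once in each row and in each column. Two Latin squares $L=(l_{ij})$ and $L'=(l'_{ij})$ of order $k$ are LSESC if for all $i,i'\in\{1,\dots,k\}$ there is a unique $j$ with $l_{ij}=l'_{i'j}$. A complete set of LSESC of order $k$ is a set $\{L^{(1)},\dots,L^{(k-1)}\}$ of $k-1$ Latin squares of order $k$, any two distinct members of which are LSESC. To a Latin square $L$ of order $k$ associate the cubic tensor $F(L)$ whose frontal slices are the $k\times k$ permutation matrices $\mathbf{X}_1,\dots,\mathbf{X}_k$, the $(i,j)$ entry of $\mathbf{X}_t$ being $1$ if $l_{it}=j$ and $0$ otherwise. A complete tensor set of LSESC of order $k$ is $\{F(L^{(1)}),\dots,F(L^{(k-1)})\}$ for a complete set of LSESC $\{L^{(1)},\dots,L^{(k-1)}\}$ of order $k$. *)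

theory Defs
  imports
    "Jordan_Normal_Form.Schur_Decomposition"
    "HOL-Combinatorics.Permutations"
begin

(* Matrix indices start at 0, so the second, fourth, ... columns are the odd ones. *)

definition BH :: "nat \<Rightarrow> nat \<Rightarrow> complex mat set" where
  "BH m n = {M \<in> carrier_mat n n.
     (\<forall>i<n. \<forall>j<n. (M $$ (i, j)) ^ m = 1) \<and>
     M * mat_adjoint M = of_nat n \<cdot>\<^sub>m 1\<^sub>m n}"

definition normalized_BH :: "nat \<Rightarrow> nat \<Rightarrow> complex mat set" where
  "normalized_BH m n = {M \<in> BH m n. \<forall>i<n. M $$ (0, i) = 1 \<and> M $$ (i, 0) = 1}"

definition alternate_signs :: "complex vec \<Rightarrow> complex vec" where
  "alternate_signs x = vec (dim_vec x) (\<lambda>j. (-1) ^ j * x $ j)"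

definition BH_A1 :: "nat \<Rightarrow> nat \<Rightarrow> complex mat set" where
  "BH_A1 m n = {M \<in> normalized_BH m n.
     \<exists>x \<in> set (rows M). alternate_signs x \<in> set (rows M)}"

definition BH_A2 :: "nat \<Rightarrow> nat \<Rightarrow> complex mat set" where
  "BH_A2 m n = {M \<in> normalized_BH m n.
     \<exists>i<n. \<exists>j<n. (\<forall>l<n. M $$ (i, l) \<in> {1, -1}) \<and>
       (\<forall>l<n. M $$ (l, j) \<in> {1, -1}) \<and> M $$ (i, j) = -1}"

(* (1, -1, 1, ..., 1, -1, ..., -1), with (n - 2) / 2 ones and (n - 2) / 2 minus ones
   after the first two entries *)
definition second_line :: "nat \<Rightarrow> complex vec" where
  "second_line n = vec n (\<lambda>i. if i = 0 then 1 else if i = 1 then -1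
                               else if i < 2 + (n - 2) div 2 then 1 else -1)"

definition T_arranged :: "nat \<Rightarrow> complex mat \<Rightarrow> bool" where
  "T_arranged n K \<longleftrightarrow> K \<in> carrier_mat n n \<and>
     row K 0 = vec n (\<lambda>_. 1) \<and> col K 0 = vec n (\<lambda>_. 1) \<and>
     row K 1 = second_line n \<and> col K 1 = second_line n"

definition T_submatrix :: "nat \<Rightarrow> complex mat \<Rightarrow> complex mat \<Rightarrow> bool" where
  "T_submatrix n H T \<longleftrightarrow> (\<exists>p q K. p permutes {..<n} \<and> q permutes {..<n} \<and>
     K = mat n n (\<lambda>(i, j). H $$ (p i, q j)) \<and> T_arranged n K \<and>
     T = mat (n - 2) (n - 2) (\<lambda>(i, j). K $$ (i + 2, j + 2)))"

(* Rows and columns are indexed from 0, but the symbols are 1, ..., k. *)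
definition latin_square :: "nat \<Rightarrow> nat mat \<Rightarrow> bool" where
  "latin_square k L \<longleftrightarrow> L \<in> carrier_mat k k \<and>
     (\<forall>i<k. \<forall>j<k. L $$ (i, j) \<in> {1..k}) \<and>
     (\<forall>i<k. \<forall>a\<in>{1..k}. \<exists>!j. j < k \<and> L $$ (i, j) = a) \<and>
     (\<forall>j<k. \<forall>a\<in>{1..k}. \<exists>!i. i < k \<and> L $$ (i, j) = a)"

definition LSESC :: "nat \<Rightarrow> nat mat \<Rightarrow> nat mat \<Rightarrow> bool" where
  "LSESC k L L' \<longleftrightarrow> latin_square k L \<and> latin_square k L' \<and>
     (\<forall>i<k. \<forall>i'<k. \<exists>!j. j < k \<and> L $$ (i, j) = L' $$ (i', j))"

definition complete_LSESC :: "nat \<Rightarrow> nat mat set \<Rightarrow> bool" where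
  "complete_LSESC k S \<longleftrightarrow> finite S \<and> card S = k - 1 \<and>
     (\<forall>L\<in>S. latin_square k L) \<and>
     (\<forall>L\<in>S. \<forall>L'\<in>S. L \<noteq> L' \<longrightarrow> LSESC k L L')"

(* A cubic tensor is represented by the list of its frontal slices. *)
definition latin_tensor :: "nat \<Rightarrow> nat mat \<Rightarrow> complex mat list" where
  "latin_tensor k L =
     map (\<lambda>t. mat k k (\<lambda>(i, j). if L $$ (i, t) = Suc j then 1 else 0)) [0..<k]"

definition complete_tensor_set :: "nat \<Rightarrow> complex mat list set \<Rightarrow> bool" where
  "complete_tensor_set k XX \<longleftrightarrow> (\<exists>S. complete_LSESC k S \<and> XX = latin_tensor k ` S)"

definition kronecker :: "complex mat \<Rightarrow> complex mat \<Rightarrow> complex mat" where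
  "kronecker A B = mat (dim_row A * dim_row B) (dim_col A * dim_col B)
     (\<lambda>(i, j). A $$ (i div dim_row B, j div dim_col B) * B $$ (i mod dim_row B, j mod dim_col B))"

definition ones_row :: "nat \<Rightarrow> complex mat" where
  "ones_row k = mat 1 k (\<lambda>_. 1)"

definition append_cols :: "complex mat \<Rightarrow> complex mat \<Rightarrow> complex mat" where
  "append_cols A B = four_block_mat A B (0\<^sub>m 0 (dim_col A)) (0\<^sub>m 0 (dim_col B))"

(* The p by q array of blocks f a b, each of size r by c. *)
definition uniform_block_mat ::
  "nat \<Rightarrow> nat \<Rightarrow> nat \<Rightarrow> nat \<Rightarrow> (nat \<Rightarrow> nat \<Rightarrow> complex mat) \<Rightarrow> complex mat" where
  "uniform_block_mat p q r c f =
     mat (p * r) (q * c) (\<lambda>(i, j). f (i div r) (j div c) $$ (i mod r, j mod c))"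

definition top_half :: "complex mat \<Rightarrow> complex mat" where
  "top_half T = mat (dim_row T div 2) (dim_col T) (\<lambda>(i, j). T $$ (i, j))"

definition bottom_half :: "complex mat \<Rightarrow> complex mat" where
  "bottom_half T = mat (dim_row T div 2) (dim_col T) (\<lambda>(i, j). T $$ (i + dim_row T div 2, j))"

definition left_half :: "complex mat \<Rightarrow> complex mat" where
  "left_half T = mat (dim_row T) (dim_col T div 2) (\<lambda>(i, j). T $$ (i, j))"

definition right_half :: "complex mat \<Rightarrow> complex mat" where
  "right_half T = mat (dim_row T) (dim_col T div 2) (\<lambda>(i, j). T $$ (i, j + dim_col T div 2))"

definition scaled_halves :: "complex \<Rightarrow> complex \<Rightarrow> complex mat \<Rightarrow> complex mat" where
  "scaled_halves a b A = append_cols (a \<cdot>\<^sub>m left_half A) (b \<cdot>\<^sub>m right_half A)"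

(* E_block k T i a b is the matrix E_{i+1}(a, b). *)
definition E_block :: "nat \<Rightarrow> complex mat \<Rightarrow> nat \<Rightarrow> complex \<Rightarrow> complex \<Rightarrow> complex mat" where
  "E_block k T i a b =
     kronecker (transpose_mat (ones_row k)) (scaled_halves a b (mat_of_row (row (top_half T) i))) @\<^sub>r
     kronecker (transpose_mat (ones_row k)) (scaled_halves a b (mat_of_row (row (bottom_half T) i)))"

(* Deletes x and its sign alternation; the rows of a Butson matrix are pairwise distinct. *)
definition delete_pair :: "complex mat \<Rightarrow> complex vec \<Rightarrow> complex mat" where
  "delete_pair G x =
     mat_of_rows (dim_col G) (filter (\<lambda>v. v \<noteq> x \<and> v \<noteq> alternate_signs x) (rows G))"

definition Psi_top :: "nat \<Rightarrow> complex mat \<Rightarrow> complex vec \<Rightarrow> complex mat" where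
  "Psi_top n G x = kronecker (delete_pair G x) (ones_row (n div 2 - 1))"

(* Xs s is the s-th tensor, 1 \<le> s \<le> n / 2 - 2; its k-th frontal slice, k \<ge> 1, is Xs s ! (k - 1).
   Block column b \<ge> 1 carries the entries numbered 2 b + 1 and 2 b + 2 of x. *)
definition Psi_bottom ::
  "nat \<Rightarrow> (nat \<Rightarrow> complex mat list) \<Rightarrow> complex vec \<Rightarrow> complex mat \<Rightarrow> complex mat" where
  "Psi_bottom n Xs x T =
     uniform_block_mat (n div 2 - 1) (n div 2) (n - 2) (n - 2)
       (\<lambda>s b. if b = 0 then E_block (n div 2 - 1) T s (x $ 0) (x $ 1)
              else if s = 0 then scaled_halves (x $ (2 * b)) (x $ (2 * b + 1)) T
              else kronecker (1\<^sub>m 2) (Xs s ! (b - 1)) *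
                   scaled_halves (x $ (2 * b)) (x $ (2 * b + 1)) T)"

definition Psi ::
  "nat \<Rightarrow> (nat \<Rightarrow> complex mat list) \<Rightarrow> complex mat \<Rightarrow> complex vec \<Rightarrow> complex mat \<Rightarrow> complex mat" where
  "Psi n Xs G x T = Psi_top n G x @\<^sub>r Psi_bottom n Xs x T"

end

theory Submission
  imports Defs
begin

text \<open>
  Put \<open>k = n/2 - 1\<close>.  Two rows of the bottom part that come from different halves of \<open>T\<close> are
  orthogonal in every block.  Within the same half, a block contributes \<open>n - 2\<close> if both rows carry the
  same row of \<open>T\<close> and \<open>-2\<close> otherwise, because rows of \<open>H\<close> are orthogonal and the two deleted columns
  contribute \<open>2\<close>.  The inner product is therefore \<open>n\<close> times the number of agreements minus
  \<open>2 (k + 1) = n\<close>, and the Latin squares are arranged so that distinct rows agree in exactly one of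
  the \<open>k + 1\<close> blocks.  Each half of a row of \<open>T\<close> sums to \<open>-1\<close> or \<open>1\<close>, so the inner product of a row
  of the top part with a row of the bottom part is, up to sign, the inner product of a row of \<open>G'\<close>
  with one of the two rows deleted from \<open>G\<close>.
\<close>

section \<open>Butson matrices as conditions on inner products of rows\<close>

text \<open>Entry \<open>(i, j)\<close> of \<open>M * mat_adjoint M\<close> is the Hermitian inner
  product of rows \<open>i\<close> and \<open>j\<close>, so all later work is with finite sums of
  complex numbers.\<close>

lemma BH_iff:
  "M \<in> BH m n \<longleftrightarrow> M \<in> carrier_mat n n \<and> (\<forall>i<n. \<forall>j<n. (M $$ (i, j)) ^ m = 1) \<and>
     (\<forall>i<n. \<forall>j<n. (\<Sum>c<n. M $$ (i, c) * cnj (M $$ (j, c))) = (if i = j then of_nat n else 0))"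
proof -
  have "M * mat_adjoint M = of_nat n \<cdot>\<^sub>m 1\<^sub>m n \<longleftrightarrow>
    (\<forall>i<n. \<forall>j<n. (\<Sum>c<n. M $$ (i, c) * cnj (M $$ (j, c))) = (if i = j then of_nat n else 0))"
    if M: "M \<in> carrier_mat n n"
  proof -
    have A: "mat_adjoint M \<in> carrier_mat n n"
      using M by (auto simp: mat_adjoint_def)
    have adj: "mat_adjoint M $$ (c, j) = cnj (M $$ (j, c))" if "c < n" "j < n" for c j
      using M that by (simp add: mat_adjoint_def mat_of_rows_index)
    have e: "(M * mat_adjoint M) $$ (i, j) = (\<Sum>c<n. M $$ (i, c) * cnj (M $$ (j, c)))"
      if "i < n" "j < n" for i j
    proof -
      have "(M * mat_adjoint M) $$ (i, j) = (\<Sum>c<n. M $$ (i, c) * mat_adjoint M $$ (c, j))"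
        using M A that by (simp add: scalar_prod_def atLeast0LessThan)
      also have "\<dots> = (\<Sum>c<n. M $$ (i, c) * cnj (M $$ (j, c)))"
        using that by (intro sum.cong refl) (simp add: adj)
      finally show ?thesis .
    qed
    show ?thesis
    proof (intro iffI allI impI)
      fix i j assume h: "M * mat_adjoint M = of_nat n \<cdot>\<^sub>m 1\<^sub>m n" and ij: "i < n" "j < n"
      show "(\<Sum>c<n. M $$ (i, c) * cnj (M $$ (j, c))) = (if i = j then of_nat n else 0)"
        unfolding e[OF ij, symmetric] h using ij by simp
    next
      assume h: "\<forall>i<n. \<forall>j<n. (\<Sum>c<n. M $$ (i, c) * cnj (M $$ (j, c))) = (if i = j then of_nat n else 0)"
      show "M * mat_adjoint M = of_nat n \<cdot>\<^sub>m 1\<^sub>m n"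
      proof (rule eq_matI)
        fix i j assume "i < dim_row (of_nat n \<cdot>\<^sub>m 1\<^sub>m n :: complex mat)" "j < dim_col (of_nat n \<cdot>\<^sub>m 1\<^sub>m n :: complex mat)"
        then have ij: "i < n" "j < n" by auto
        show "(M * mat_adjoint M) $$ (i, j) = (of_nat n \<cdot>\<^sub>m 1\<^sub>m n) $$ (i, j)"
          unfolding e[OF ij] using h ij by simp
      qed (use M A in auto)
    qed
  qed
  then show ?thesis by (auto simp: BH_def)
qed

text \<open>Such a \<open>z\<close> has norm 1. This removes the entries of \<open>x\<close> from
  inner products of two bottom rows.\<close>

lemma root_of_unity_mult_cnj:
  fixes z :: complex
  assumes "z ^ m = 1" "m > 0"
  shows "z * cnj z = 1"
proof -
  have "norm z ^ m = 1" using arg_cong[OF assms(1), of norm] by (simp add: norm_power)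
  then have "norm z = 1" using assms(2) power_eq_imp_eq_base[of "norm z" m 1] by simp
  then show ?thesis by (simp add: complex_norm_square[symmetric])
qed

text \<open>Used at three widths: \<open>2 * k\<close> for block columns, \<open>k\<close> for the
  halves of a row of \<open>T\<close>, and 2 for consecutive pairs of entries of a row of
  \<open>G\<close>.\<close>

lemma sum_over_blocks:
  fixes f :: "nat \<Rightarrow> 'a::comm_monoid_add"
  shows "(\<Sum>c<q * w. f c) = (\<Sum>b<q. \<Sum>j<w. f (b * w + j))"
proof -
  have "(\<Sum>b<q. \<Sum>j<w. f (b * w + j)) = (\<Sum>b<q. sum f {b * w..<b * w + w})"
  proof (rule sum.cong[OF refl])
    fix b
    show "(\<Sum>j<w. f (b * w + j)) = sum f {b * w..<b * w + w}"
      by (rule sum.reindex_bij_witness[where i = "\<lambda>c. c - b * w" and j = "\<lambda>j. b * w + j"]) auto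
  qed
  also have "\<dots> = (\<Sum>c<q * w. f c)" by (rule sum.nat_group)
  finally show ?thesis by simp
qed

section \<open>Entries of the bottom part, and agreements between its rows\<close>

lemma append_cols_index:
  assumes "A \<in> carrier_mat r a" "B \<in> carrier_mat r b" "i < r" "j < a + b"
  shows "append_cols A B $$ (i, j) = (if j < a then A $$ (i, j) else B $$ (i, j - a))"
  using assms by (simp add: append_cols_def)

lemma scaled_halves_carrier:
  assumes "A \<in> carrier_mat r (2 * k)"
  shows "scaled_halves a b A \<in> carrier_mat r (2 * k)"
  using assms by (auto simp: scaled_halves_def append_cols_def left_half_def right_half_def)

lemma scaled_halves_index:
  assumes "A \<in> carrier_mat r (2 * k)" "i < r" "j < 2 * k"
  shows "scaled_halves a b A $$ (i, j) = (if j < k then a else b) * A $$ (i, j)"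
proof -
  have "a \<cdot>\<^sub>m left_half A \<in> carrier_mat r k" "b \<cdot>\<^sub>m right_half A \<in> carrier_mat r k"
    using assms by (auto simp: left_half_def right_half_def)
  from append_cols_index[OF this assms(2)] show ?thesis
    using assms by (auto simp: scaled_halves_def left_half_def right_half_def)
qed

lemma append_rows_index:
  assumes "A \<in> carrier_mat a c" "B \<in> carrier_mat b c" "i < a + b" "j < c"
  shows "(A @\<^sub>r B) $$ (i, j) = (if i < a then A $$ (i, j) else B $$ (i - a, j))"
  using assms by (auto simp: append_rows_def)

lemma ones_col_kronecker:
  assumes "A \<in> carrier_mat 1 w"
  shows "kronecker (transpose_mat (ones_row k)) A = mat k w (\<lambda>(i, j). A $$ (0, j))"
  using assms by (intro eq_matI) (auto simp: kronecker_def ones_row_def)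

text \<open>Here and below a row of \<open>T\<close> is addressed as \<open>h * k + i\<close>, with
  \<open>h = 0\<close> for the half \<open>C\<close> and \<open>h = 1\<close> for \<open>D\<close>.
  The Kronecker product with a column of ones makes all rows of one half equal, hence
  \<open>i\<close> is absent on the right.\<close>

lemma E_block_index:
  assumes T: "T \<in> carrier_mat (2 * k) (2 * k)" and s: "s < k" and h: "h < 2" and i: "i < k"
    and j: "j < 2 * k"
  shows "E_block k T s a b $$ (h * k + i, j) = (if j < k then a else b) * T $$ (h * k + s, j)"
proof -
  let ?t = "mat_of_row (row (top_half T) s)" and ?b = "mat_of_row (row (bottom_half T) s)"
  have c: "?t \<in> carrier_mat 1 (2 * k)" "?b \<in> carrier_mat 1 (2 * k)"
    using T by (auto simp: mat_of_row_def top_half_def bottom_half_def)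
  have e: "?t $$ (0, j) = T $$ (s, j)" "?b $$ (0, j) = T $$ (k + s, j)"
    using T s j by (auto simp: mat_of_row_def top_half_def bottom_half_def add.commute)
  note sc = scaled_halves_carrier[OF c(1), of a b] scaled_halves_carrier[OF c(2), of a b]
  have "E_block k T s a b = mat k (2 * k) (\<lambda>(i, j). scaled_halves a b ?t $$ (0, j)) @\<^sub>r
     mat k (2 * k) (\<lambda>(i, j). scaled_halves a b ?b $$ (0, j))"
    unfolding E_block_def by (simp add: ones_col_kronecker[OF sc(1)] ones_col_kronecker[OF sc(2)])
  moreover have "h = 0 \<or> h = 1" using h by auto
  ultimately show ?thesis
    using i j e
    by (auto simp: append_rows_index[where a = k and b = k and c = "2 * k"]
        scaled_halves_index[OF c(1)] scaled_halves_index[OF c(2)])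
qed

text \<open>Row \<open>i\<close> of the slice has its single 1 in column
  \<open>L $$ (i, t) - 1\<close>, as symbols start at 1, and the factor \<open>1\<^sub>m 2\<close>
  makes the same selection inside each half without mixing the halves.\<close>

lemma kronecker_slice_mult:
  assumes L: "latin_square k L" and t: "t < k" and A: "A \<in> carrier_mat (2 * k) w"
    and h: "h < 2" and i: "i < k" and j: "j < w"
  shows "(kronecker (1\<^sub>m 2) (latin_tensor k L ! t) * A) $$ (h * k + i, j)
    = A $$ (h * k + (L $$ (i, t) - 1), j)"
proof -
  let ?P = "latin_tensor k L ! t"
  have P: "?P = mat k k (\<lambda>(i, j). if L $$ (i, t) = Suc j then 1 else 0)"
    using t by (simp add: latin_tensor_def)
  have K: "kronecker (1\<^sub>m 2) ?P \<in> carrier_mat (2 * k) (2 * k)"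
    by (auto simp: kronecker_def P)
  have "L $$ (i, t) \<in> {1..k}" using L i t by (auto simp: latin_square_def)
  then obtain y where y: "L $$ (i, t) = Suc y" "y < k" by (cases "L $$ (i, t)") auto
  have hi: "h * k + i < 2 * k" "h * k + y < 2 * k" using h i y by (cases h; auto)+
  have e: "kronecker (1\<^sub>m 2) ?P $$ (h * k + i, l) = (if l = h * k + y then 1 else 0)" if l: "l < 2 * k" for l
  proof -
    have d: "l div k < 2" "l mod k < k" using l i by (auto simp: less_mult_imp_div_less)
    \<comment> \<open>Uniqueness of quotient and remainder merges the two indicator factors of the
      Kronecker product into one.\<close>
    have "l = h * k + y \<longleftrightarrow> h = l div k \<and> y = l mod k"
      using y(2) by auto
    moreover have "kronecker (1\<^sub>m 2) ?P $$ (h * k + i, l) =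
        (if h = l div k then 1 else 0) * (if y = l mod k then 1 else 0)"
      using hi l d h i y by (simp add: kronecker_def P)
    ultimately show ?thesis by auto
  qed
  have "(kronecker (1\<^sub>m 2) ?P * A) $$ (h * k + i, j)
      = (\<Sum>l<2 * k. kronecker (1\<^sub>m 2) ?P $$ (h * k + i, l) * A $$ (l, j))"
    using K A hi j by (auto simp: scalar_prod_def atLeast0LessThan intro!: sum.cong)
  also have "\<dots> = (\<Sum>l<2 * k. if l = h * k + y then A $$ (l, j) else 0)"
    by (rule sum.cong) (auto simp: e)
  also have "\<dots> = A $$ (h * k + y, j)" using hi by simp
  finally show ?thesis using y by simp
qed

text \<open>The row of \<open>C\<close> (or of \<open>D\<close>) that row \<open>i\<close> of block row \<open>s\<close> of \<open>B\<close> repeats, up to scaling,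
  in block column \<open>b\<close>.  As an array with rows \<open>(s, i)\<close> it is an orthogonal array of strength 2,
  with any two rows agreeing exactly once: an affine plane coded by the Latin squares.\<close>

definition block_symbol :: "(nat \<Rightarrow> nat mat) \<Rightarrow> nat \<Rightarrow> nat \<Rightarrow> nat \<Rightarrow> nat" where
  "block_symbol L s i b = (if b = 0 then s else if s = 0 then i else L s $$ (i, b - 1) - 1)"

lemma block_symbol_less:
  assumes "\<And>s. s \<in> {1..<k} \<Longrightarrow> latin_square k (L s)" "s < k" "i < k" "b < Suc k"
  shows "block_symbol L s i b < k"
proof (cases "b = 0 \<or> s = 0")
  case False
  then have "L s $$ (i, b - 1) \<in> {1..k}" using assms(1)[of s] assms(2-4) by (auto simp: latin_square_def)
  then show ?thesis using False by (auto simp: block_symbol_def)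
qed (use assms in \<open>auto simp: block_symbol_def\<close>)

text \<open>For equal \<open>s\<close> and distinct \<open>i\<close> the only agreement is in block
  column 0: elsewhere the symbols come from different rows in one column of a Latin square, or are
  \<open>i\<close> and \<open>i'\<close> themselves when \<open>s = 0\<close>. For distinct
  \<open>s\<close> block column 0 disagrees, and the single agreement is the position of a symbol in
  a row of a square if one of the indices is 0, and is provided by LSESC otherwise.\<close>

lemma card_block_symbol_agree:
  assumes L: "\<And>s. s \<in> {1..<k} \<Longrightarrow> latin_square k (L s)"
    and LL: "\<And>s s'. s \<in> {1..<k} \<Longrightarrow> s' \<in> {1..<k} \<Longrightarrow> s \<noteq> s' \<Longrightarrow> LSESC k (L s) (L s')"
    and s: "s < k" "s' < k" and i: "i < k" "i' < k"
  shows "card {b. b < Suc k \<and> block_symbol L s i b = block_symbol L s' i' b}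
    = (if s = s' \<and> i = i' then Suc k else 1)"
proof -
  let ?f = "block_symbol L"
  have one: "card {b. b < Suc k \<and> ?f s i b = ?f s' i' b} = 1"
    if u: "\<exists>!b. b < Suc k \<and> ?f s i b = ?f s' i' b" for s i s' i'
  proof -
    from u obtain b where "{b. b < Suc k \<and> ?f s i b = ?f s' i' b} = {b}" by auto
    then show ?thesis by simp
  qed
  \<comment> \<open>Block column 0 carries \<open>s\<close> and \<open>s'\<close>, which differ, so
    agreements are sought only in block columns \<open>Suc j\<close>, that is, in columns
    \<open>j\<close> of the squares.\<close>
  have shift: "\<exists>!b. b < Suc k \<and> ?f s i b = ?f s' i' b"
    if "s \<noteq> s'" and u: "\<exists>!j. j < k \<and> ?f s i (Suc j) = ?f s' i' (Suc j)" for s i s' i'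
  proof -
    from u obtain j where j: "j < k" "?f s i (Suc j) = ?f s' i' (Suc j)"
      and un: "\<And>j'. j' < k \<Longrightarrow> ?f s i (Suc j') = ?f s' i' (Suc j') \<Longrightarrow> j' = j" by blast
    show ?thesis
    proof (rule ex1I[of _ "Suc j"])
      fix b assume b: "b < Suc k \<and> ?f s i b = ?f s' i' b"
      with \<open>s \<noteq> s'\<close> obtain j' where "b = Suc j'" by (cases b) (auto simp: block_symbol_def)
      with un b show "b = Suc j" by auto
    qed (use j in auto)
  qed
  \<comment> \<open>Entries are at least 1, so the truncated subtraction of 1 in
    \<open>block_symbol\<close> is injective on them.\<close>
  have pos: "L s $$ (i, j) \<in> {1..k}" if "s \<in> {1..<k}" "i < k" "j < k" for s i j
    using L[OF that(1)] that by (auto simp: latin_square_def)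
  \<comment> \<open>Block row 0 carries \<open>i'\<close> in every block column after the first, so
    an agreement there is an occurrence of the symbol \<open>Suc i'\<close> in row \<open>i\<close>
    of \<open>L s\<close>.\<close>
  have zero: "\<exists>!b. b < Suc k \<and> ?f s i b = ?f 0 i' b" if s: "s \<in> {1..<k}" and i: "i < k" "i' < k" for s i i'
  proof (rule shift)
    have "\<exists>!j. j < k \<and> L s $$ (i, j) = Suc i'"
      using L[OF s] i by (simp add: latin_square_def)
    moreover have "?f s i (Suc j) = ?f 0 i' (Suc j) \<longleftrightarrow> L s $$ (i, j) = Suc i'" if "j < k" for j
      using pos[OF s i(1) that] s by (auto simp: block_symbol_def)
    ultimately show "\<exists>!j. j < k \<and> ?f s i (Suc j) = ?f 0 i' (Suc j)" by (metis (no_types, lifting))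
  qed (use s in auto)
  consider "s = s'" "i = i'" | "s = s'" "i \<noteq> i'" | "s \<noteq> s'" "s = 0" | "s \<noteq> s'" "s' = 0"
    | "s \<noteq> s'" "s \<noteq> 0" "s' \<noteq> 0" by blast
  then show ?thesis
  proof cases
    case 1
    then show ?thesis by simp
  next
    case 2
    have "\<exists>!b. b < Suc k \<and> ?f s i b = ?f s i' b"
    proof (rule ex1I[of _ 0])
      fix b assume b: "b < Suc k \<and> ?f s i b = ?f s i' b"
      show "b = 0"
      proof (rule ccontr)
        assume "b \<noteq> 0"
        then obtain j where j: "b = Suc j" "j < k" using b by (cases b) auto
        have s0: "s \<noteq> 0"
        proof
          assume "s = 0"
          then have "?f s i b = i" "?f s i' b = i'" using j by (simp_all add: block_symbol_def)
          with b have "i = i'" by metis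
          with 2(2) show False ..
        qed
        then have s1: "s \<in> {1..<k}" using s by auto
        have "L s $$ (i, j) = L s $$ (i', j)"
          using b j s0 pos[OF s1 i(1) j(2)] pos[OF s1 i(2) j(2)] by (auto simp: block_symbol_def)
        moreover have "\<exists>!i. i < k \<and> L s $$ (i, j) = L s $$ (i', j)"
          using L[OF s1] j(2) pos[OF s1 i(2) j(2)] by (auto simp: latin_square_def)
        ultimately show False using 2 i by blast
      qed
    qed (auto simp: block_symbol_def)
    then show ?thesis using 2 one by auto
  next
    case 3
    then have "\<exists>!b. b < Suc k \<and> ?f s' i' b = ?f 0 i b" using zero[of s' i' i] s i by auto
    then have "card {b. b < Suc k \<and> ?f s' i' b = ?f 0 i b} = 1" by (rule one)
    moreover have "{b. b < Suc k \<and> ?f s i b = ?f s' i' b} = {b. b < Suc k \<and> ?f s' i' b = ?f 0 i b}"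
      using 3 by auto
    ultimately show ?thesis using 3 by simp
  next
    case 4
    then have "\<exists>!b. b < Suc k \<and> ?f s i b = ?f 0 i' b" using zero[of s i i'] s i by auto
    then show ?thesis using 4 one[of s i 0 i'] by simp
  next
    case 5
    then have ss: "s \<in> {1..<k}" "s' \<in> {1..<k}" using s by auto
    have "\<exists>!b. b < Suc k \<and> ?f s i b = ?f s' i' b"
    proof (rule shift)
      have "\<exists>!j. j < k \<and> L s $$ (i, j) = L s' $$ (i', j)"
        using LL[OF ss] 5 i by (auto simp: LSESC_def)
      moreover have "?f s i (Suc j) = ?f s' i' (Suc j) \<longleftrightarrow> L s $$ (i, j) = L s' $$ (i', j)" if "j < k" for j
        using pos[OF ss(1) i(1) that] pos[OF ss(2) i(2) that] 5 by (auto simp: block_symbol_def)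
      ultimately show "\<exists>!j. j < k \<and> ?f s i (Suc j) = ?f s' i' (Suc j)" by (metis (no_types, lifting))
    qed (use 5 in auto)
    then show ?thesis using 5 one by simp
  qed
qed

text \<open>Puts the three kinds of blocks under one formula. The quotient \<open>j div k\<close> is
  0 in the left half of the columns and 1 in the right half, which selects entry
  \<open>2 * b\<close> or \<open>2 * b + 1\<close> of \<open>x\<close>.\<close>

lemma Psi_bottom_index:
  assumes n: "n = 2 * Suc k" and T: "T \<in> carrier_mat (2 * k) (2 * k)"
    and L: "\<And>s. s \<in> {1..<k} \<Longrightarrow> latin_square k (L s)"
    and Xs: "\<And>s. s \<in> {1..<k} \<Longrightarrow> Xs s = latin_tensor k (L s)"
    and s: "s < k" and h: "h < 2" and i: "i < k" and b: "b < Suc k" and j: "j < 2 * k"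
  shows "Psi_bottom n Xs x T $$ (s * (2 * k) + (h * k + i), b * (2 * k) + j)
    = x $ (2 * b + j div k) * T $$ (h * k + block_symbol L s i b, j)"
proof -
  have hi: "h * k + i < 2 * k" using h i by (cases h) auto
  have "Suc s * (2 * k) \<le> k * (2 * k)" "Suc b * (2 * k) \<le> Suc k * (2 * k)"
    by (rule mult_le_mono1; use s b in simp)+
  then have lt: "s * (2 * k) + (h * k + i) < k * (2 * k)" "b * (2 * k) + j < Suc k * (2 * k)"
    unfolding mult_Suc using hi j by linarith+
  have nn: "n div 2 - 1 = k" "n div 2 = Suc k" "n - 2 = 2 * k" using n by auto
  have jk: "x $ (2 * b + j div k) = (if j < k then x $ (2 * b) else x $ (2 * b + 1))"
  proof -
    have "j div k = 1" if "\<not> j < k" using that j by (auto intro!: div_nat_eqI)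
    then show ?thesis by auto
  qed
  let ?S = "scaled_halves (x $ (2 * b)) (x $ (2 * b + 1)) T"
  have S: "?S \<in> carrier_mat (2 * k) (2 * k)" by (rule scaled_halves_carrier[OF T])
  have "Psi_bottom n Xs x T $$ (s * (2 * k) + (h * k + i), b * (2 * k) + j) =
     (if b = 0 then E_block k T s (x $ 0) (x $ 1)
      else if s = 0 then ?S else kronecker (1\<^sub>m 2) (Xs s ! (b - 1)) * ?S) $$ (h * k + i, j)"
    unfolding Psi_bottom_def uniform_block_mat_def nn
    by (subst index_mat) (use lt hi j i in auto)
  also have "\<dots> = x $ (2 * b + j div k) * T $$ (h * k + block_symbol L s i b, j)"
  proof -
    consider "b = 0" | "b \<noteq> 0" "s = 0" | "b \<noteq> 0" "s \<noteq> 0" by blast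
    then show ?thesis
    proof cases
      case 1
      then show ?thesis unfolding jk using E_block_index[OF T s h i j, of "x $ 0" "x $ 1"]
        by (simp add: block_symbol_def)
    next
      case 2
      then show ?thesis unfolding jk using scaled_halves_index[OF T hi j] by (simp add: block_symbol_def)
    next
      case 3
      then have s1: "s \<in> {1..<k}" using s by auto
      have "h * k + block_symbol L s i b < 2 * k"
        using block_symbol_less[where L = L, OF L s i b] h by (cases h) auto
      then show ?thesis
        unfolding jk using kronecker_slice_mult[OF L[OF s1] _ S h i j, of "b - 1"] 3 b
          scaled_halves_index[OF T _ j]
        by (simp add: block_symbol_def Xs[OF s1])
    qed
  qed
  finally show ?thesis .
qed

section \<open>Inner products and half sums of the rows of T\<close>

text \<open>The tail of \<open>second_line\<close> in the coordinates of \<open>T\<close>: what the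
  second deleted column holds beside row \<open>p\<close>, and the second deleted row above column
  \<open>p\<close>.\<close>

definition half_sign :: "nat \<Rightarrow> nat \<Rightarrow> complex" where
  "half_sign k p = (if p < k then 1 else -1)"

lemma sum_lessThan_add_two:
  fixes f :: "nat \<Rightarrow> 'a::comm_monoid_add"
  shows "(\<Sum>c<2 * Suc k. f c) = f 0 + (f 1 + (\<Sum>j<2 * k. f (j + 2)))"
  by (simp add: sum.lessThan_Suc_shift del: sum.lessThan_Suc)

text \<open>The sums all come from row orthogonality of the rearranged matrix \<open>K\<close>. Two
  rows below the first two give the inner products, once the deleted columns are split off. Such a
  row against the first two rows gives the sum and the difference of its half sums, hence
  both.\<close>

lemma T_submatrix_props:
  assumes n: "n = 2 * Suc k" and H: "H \<in> BH m n" and T: "T_submatrix n H T"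
  shows "T \<in> carrier_mat (2 * k) (2 * k)"
    and "\<And>p j. p < 2 * k \<Longrightarrow> j < 2 * k \<Longrightarrow> (T $$ (p, j)) ^ m = 1"
    and "\<And>p q. p < 2 * k \<Longrightarrow> q < 2 * k \<Longrightarrow> (\<Sum>j<2 * k. T $$ (p, j) * cnj (T $$ (q, j)))
      = (if p = q then of_nat n else 0) - 1 - half_sign k p * half_sign k q"
    and "\<And>p. p < 2 * k \<Longrightarrow> (\<Sum>j<k. T $$ (p, j)) = -1"
    and "\<And>p. p < 2 * k \<Longrightarrow> (\<Sum>j<k. T $$ (p, k + j)) = - half_sign k p"
proof -
  from T obtain f g K where f: "f permutes {..<n}" and g: "g permutes {..<n}"
    and K: "K = mat n n (\<lambda>(i, j). H $$ (f i, g j))" and ar: "T_arranged n K"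
    and TK: "T = mat (n - 2) (n - 2) (\<lambda>(i, j). K $$ (i + 2, j + 2))"
    unfolding T_submatrix_def by blast
  have n2: "n - 2 = 2 * k" "(n - 2) div 2 = k" using n by auto
  have fl: "f i < n" "g i < n" if "i < n" for i
    using that permutes_in_image[OF f, of i] permutes_in_image[OF g, of i] by auto
  have Hr: "H $$ (i, j) ^ m = 1" if "i < n" "j < n" for i j
    using H that by (auto simp: BH_iff)
  have Ho: "(\<Sum>c<n. H $$ (i, c) * cnj (H $$ (j, c))) = (if i = j then of_nat n else 0)"
    if "i < n" "j < n" for i j using H that by (auto simp: BH_iff)
  \<comment> \<open>Rearranging keeps orthogonality: \<open>g\<close> only reorders the summands,
    and \<open>f\<close> is injective.\<close>
  have Ko: "(\<Sum>c<n. K $$ (i, c) * cnj (K $$ (j, c))) = (if i = j then of_nat n else 0)"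
    if ij: "i < n" "j < n" for i j
  proof -
    have "(\<Sum>c<n. K $$ (i, c) * cnj (K $$ (j, c))) = (\<Sum>c<n. H $$ (f i, g c) * cnj (H $$ (f j, g c)))"
      using ij by (auto simp: K)
    also have "\<dots> = (\<Sum>c<n. H $$ (f i, c) * cnj (H $$ (f j, c)))"
      by (rule sum.permute[OF g, symmetric, unfolded comp_def])
    also have "\<dots> = (if i = j then of_nat n else 0)"
      using Ho[of "f i" "f j"] fl ij inj_eq[OF permutes_inj[OF f]] by auto
    finally show ?thesis .
  qed
  have Kc: "K \<in> carrier_mat n n" by (simp add: K)
  have K0: "K $$ (0, j) = 1" "K $$ (j, 0) = 1" "K $$ (1, j) = second_line n $ j" "K $$ (j, 1) = second_line n $ j"
    if "j < n" for j
  proof -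
    have "row K 0 $ j = 1" "col K 0 $ j = 1" "row K 1 $ j = second_line n $ j" "col K 1 $ j = second_line n $ j"
      using ar that by (simp_all add: T_arranged_def)
    then show "K $$ (0, j) = 1" "K $$ (j, 0) = 1" "K $$ (1, j) = second_line n $ j" "K $$ (j, 1) = second_line n $ j"
      using that Kc n by auto
  qed
  have sl: "second_line n $ 0 = 1" "second_line n $ 1 = -1" using n by (auto simp: second_line_def)
  have slh: "second_line n $ (p + 2) = half_sign k p" if "p < 2 * k" for p
    using that n2 by (auto simp: second_line_def half_sign_def)
  have Te: "T $$ (p, j) = K $$ (p + 2, j + 2)" if "p < 2 * k" "j < 2 * k" for p j
    using that by (simp add: TK n2)
  have Kp: "K $$ (p + 2, 0) = 1" "K $$ (p + 2, 1) = half_sign k p" if "p < 2 * k" for p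
    using K0(2)[of "p + 2"] K0(4)[of "p + 2"] slh[OF that] that n by auto
  \<comment> \<open>The weight \<open>u\<close> will be the conjugate of row \<open>q + 2\<close>,
    of the all-ones row 0, or of row 1 of \<open>K\<close>.\<close>
  have row_sum: "(\<Sum>c<2 * Suc k. K $$ (p + 2, c) * u c)
      = u 0 + (half_sign k p * u 1 + (\<Sum>j<2 * k. T $$ (p, j) * u (j + 2)))" if "p < 2 * k" for p u
    unfolding sum_lessThan_add_two Kp[OF that] using that by (simp add: Te)
  show "T \<in> carrier_mat (2 * k) (2 * k)" by (simp add: TK n2)
  show "(T $$ (p, j)) ^ m = 1" if "p < 2 * k" "j < 2 * k" for p j
    using that fl Hr n by (simp add: Te K)
  show "(\<Sum>j<2 * k. T $$ (p, j) * cnj (T $$ (q, j)))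
      = (if p = q then of_nat n else 0) - 1 - half_sign k p * half_sign k q"
    if "p < 2 * k" "q < 2 * k" for p q
  proof -
    have "(\<Sum>c<2 * Suc k. K $$ (p + 2, c) * cnj (K $$ (q + 2, c))) = (if p = q then of_nat n else 0)"
      using Ko[of "p + 2" "q + 2"] that n by simp
    then have "1 + (half_sign k p * cnj (half_sign k q) + (\<Sum>j<2 * k. T $$ (p, j) * cnj (T $$ (q, j))))
      = (if p = q then of_nat n else 0)"
      unfolding row_sum[OF that(1)] Kp[OF that(2)] using that(2) by (simp add: Te)
    moreover have "cnj (half_sign k q) = half_sign k q" by (simp add: half_sign_def)
    ultimately show ?thesis by (simp add: algebra_simps)
  qed
  have halves: "(\<Sum>j<k. T $$ (p, j)) = -1 \<and> (\<Sum>j<k. T $$ (p, k + j)) = - half_sign k p"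
    if p: "p < 2 * k" for p
  proof -
    let ?L = "\<Sum>j<k. T $$ (p, j)" and ?R = "\<Sum>j<k. T $$ (p, k + j)"
    have split: "(\<Sum>j<2 * k. u j) = (\<Sum>j<k. u j) + (\<Sum>j<k. u (k + j))" for u :: "nat \<Rightarrow> complex"
      using sum_over_blocks[of u 2 k] by (simp add: numeral_2_eq_2)
    have "(\<Sum>c<2 * Suc k. K $$ (p + 2, c) * cnj (K $$ (0, c))) = 0"
      using Ko[of "p + 2" 0] p n by simp
    moreover have "K $$ (0, 0) = 1" "K $$ (0, 1) = 1" "\<And>j. j < 2 * k \<Longrightarrow> K $$ (0, j + 2) = 1"
      using K0(1) n by auto
    ultimately have "1 + (half_sign k p + (\<Sum>j<2 * k. T $$ (p, j))) = 0"
      unfolding row_sum[OF p] by simp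
    then have e0: "1 + (half_sign k p + (?L + ?R)) = 0" by (simp only: split)
    have "(\<Sum>c<2 * Suc k. K $$ (p + 2, c) * cnj (K $$ (1, c))) = 0"
      using Ko[of "p + 2" 1] p n by simp
    moreover have "K $$ (1, 0) = 1" "K $$ (1, 1) = -1" "\<And>j. j < 2 * k \<Longrightarrow> K $$ (1, j + 2) = half_sign k j"
    proof -
      show "K $$ (1, 0) = 1" "K $$ (1, 1) = -1" using K0(3)[of 0] K0(3)[of 1] sl n by auto
      show "K $$ (1, j + 2) = half_sign k j" if "j < 2 * k" for j
        using K0(3)[of "j + 2"] slh[OF that] that n by auto
    qed
    moreover have alt: "(\<Sum>j<2 * k. T $$ (p, j) * cnj (half_sign k j)) = ?L - ?R"
      unfolding split by (simp add: half_sign_def sum_negf)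
    ultimately have "1 + (- half_sign k p + (\<Sum>j<2 * k. T $$ (p, j) * cnj (half_sign k j))) = 0"
      unfolding row_sum[OF p] by simp
    then have e1: "1 + (- half_sign k p + (?L - ?R)) = 0" by (simp only: alt)
    \<comment> \<open>Adding and subtracting the two orthogonality relations isolates
      \<open>a\<close> and \<open>b\<close>.\<close>
    have "a = -1 \<and> b = - h" if "1 + (h + (a + b)) = 0" "1 + (- h + (a - b)) = 0" for a b h :: complex
    proof -
      have "2 * (a + 1) = (1 + (h + (a + b))) + (1 + (- h + (a - b)))"
        "2 * (b + h) = (1 + (h + (a + b))) - (1 + (- h + (a - b)))"
        by (simp_all add: algebra_simps)
      then have "2 * (a + 1) = 0" "2 * (b + h) = 0" unfolding that by simp_all
      then have "a + 1 = 0" "b + h = 0" by (simp_all only: mult_eq_0_iff) simp_all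
      then show ?thesis by (simp add: eq_neg_iff_add_eq_0)
    qed
    from this[OF e0 e1] show ?thesis .
  qed
  show "(\<Sum>j<k. T $$ (p, j)) = -1" "(\<Sum>j<k. T $$ (p, k + j)) = - half_sign k p" if "p < 2 * k" for p
    using halves[OF that] by auto
qed

text \<open>Phrased for vectors, because the kept and the deleted rows are known only as members of
  \<open>rows G\<close>. Equal rows at distinct indices cannot occur: their inner product would be
  both 0 and \<open>n\<close>.\<close>

lemma rows_orthogonal:
  assumes "G \<in> BH m n" "v \<in> set (rows G)" "w \<in> set (rows G)"
  shows "(\<Sum>c<n. v $ c * cnj (w $ c)) = (if v = w then of_nat n else 0)"
proof -
  have G: "G \<in> carrier_mat n n" using assms by (simp add: BH_def)
  then obtain i j where ij: "i < n" "j < n" "v = row G i" "w = row G j"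
    using assms(2,3) by (auto simp: rows_def)
  have o: "(\<Sum>c<n. v $ c * cnj (w $ c)) = (if i = j then of_nat n else 0)"
    using assms(1) ij G by (auto simp: BH_iff)
  have "(\<Sum>c<n. v $ c * cnj (v $ c)) = of_nat n"
    using assms(1) ij G by (auto simp: BH_iff)
  then show ?thesis using o ij by (auto split: if_splits)
qed

text \<open>Ensures that deletion by value removes one row for each of the two vectors, so that the
  top part has the right height.\<close>

lemma distinct_rows:
  assumes "G \<in> BH m n"
  shows "distinct (rows G)"
proof -
  have G: "G \<in> carrier_mat n n" using assms by (simp add: BH_def)
  have "i = j" if ij: "i < n" "j < n" "row G i = row G j" for i j
  proof -
    have o: "(\<Sum>c<n. row G a $ c * cnj (row G b $ c)) = (if a = b then of_nat n else 0)"
      if "a < n" "b < n" for a b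
      using assms G that by (auto simp: BH_iff)
    have "(if i = j then of_nat n else 0) = (of_nat n :: complex)"
      using o[of i j] o[of j j] ij by simp
    then show "i = j" using ij by (auto split: if_splits)
  qed
  then show ?thesis using G by (auto simp: rows_def distinct_map inj_on_def)
qed

theorem corollary4:
  fixes m n :: nat and G H T :: "complex mat" and x :: "complex vec"
    and XX :: "complex mat list set" and Xs :: "nat \<Rightarrow> complex mat list"
  assumes "even m" and "m > 0"
    and "even n" and "n \<ge> 4"
    and "G \<in> BH_A1 m n" and "H \<in> BH_A2 m n"
    and "x \<in> set (rows G)" and "alternate_signs x \<in> set (rows G)"
    and "T_submatrix n H T"
    and "complete_tensor_set (n div 2 - 1) XX"
    and "bij_betw Xs {1..n div 2 - 2} XX"
  shows "Psi n Xs G x T \<in> BH m ((n div 2 - 1) * n)"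
proof -

  \<comment> \<open>Latin squares behind the enumerated tensors\<close>
  define k where "k = n div 2 - 1"
  have n: "n = 2 * Suc k" and k: "k > 0" using assms(3,4) by (auto simp: k_def elim!: evenE)
  have nk: "n div 2 - 1 = k" "n div 2 - Suc 0 = k" "n div 2 - 2 = k - 1" "n - 2 = 2 * k" using n by auto
  have G: "G \<in> BH m n" and H: "H \<in> BH m n"
    using assms(5,6) by (auto simp: BH_A1_def BH_A2_def normalized_BH_def)
  have Gc: "G \<in> carrier_mat n n" using G by (simp add: BH_def)
  note T = T_submatrix_props[OF n H assms(9)]
  obtain S where S: "complete_LSESC k S" "XX = latin_tensor k ` S"
    using assms(10) unfolding nk complete_tensor_set_def by blast
  \<comment> \<open>For \<open>n = 4\<close> this range is empty: there are no tensors, and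
    \<open>B\<close> has a single block row.\<close>
  have "\<exists>M. M \<in> S \<and> Xs s = latin_tensor k M" if "s \<in> {1..<k}" for s
  proof -
    have "s \<in> {1..n div 2 - 2}" using that by (auto simp: nk)
    then have "Xs s \<in> XX" by (rule bij_betwE[OF assms(11), rule_format])
    then show ?thesis using S by auto
  qed
  then obtain L where L: "\<And>s. s \<in> {1..<k} \<Longrightarrow> L s \<in> S \<and> Xs s = latin_tensor k (L s)" by metis
  have lat: "latin_square k (L s)" if "s \<in> {1..<k}" for s
    using L[OF that] S(1) by (auto simp: complete_LSESC_def)
  have Xs: "Xs s = latin_tensor k (L s)" if "s \<in> {1..<k}" for s using L[OF that] by simp
  have lsesc: "LSESC k (L s) (L s')" if "s \<in> {1..<k}" "s' \<in> {1..<k}" "s \<noteq> s'" for s s'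
  proof -
    \<comment> \<open>Distinctness of the squares is inherited from injectivity of
      \<open>Xs\<close>, since equal squares have equal tensors.\<close>
    have "Xs s \<noteq> Xs s'"
      using bij_betw_imp_inj_on[OF assms(11)] that by (auto simp: nk inj_on_def)
    then have "L s \<noteq> L s'" using L that by auto
    then show ?thesis using L that S(1) by (auto simp: complete_LSESC_def)
  qed

  \<comment> \<open>Rows kept in the top part\<close>
  define vs where "vs = filter (\<lambda>v. v \<noteq> x \<and> v \<noteq> alternate_signs x) (rows G)"
  have root: "v $ c ^ m = 1" if "v \<in> set (rows G)" "c < n" for v c
    using that G Gc by (auto simp: BH_iff rows_def)
  have dimx: "dim_vec x = n" using assms(7) Gc by (auto simp: rows_def)
  have alt: "alternate_signs x $ c = (-1) ^ c * x $ c" if "c < n" for c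
    using that dimx by (simp add: alternate_signs_def)
  \<comment> \<open>A row equal to its alternation would vanish at index 1, but 0 is no root of
    unity for \<open>m > 0\<close>.\<close>
  have ne: "x \<noteq> alternate_signs x"
  proof
    assume "x = alternate_signs x"
    then have "x $ 1 = - x $ 1" using alt[of 1] n by simp
    then have "x $ 1 = 0" by simp
    then have "(0::complex) ^ m = 1" using root[OF assms(7), of 1] n by simp
    then show False using assms(2) by (simp add: zero_power)
  qed
  have dvs: "distinct vs" using distinct_rows[OF G] by (simp add: vs_def)
  have vsG: "set vs \<subseteq> set (rows G)" "x \<notin> set vs" "alternate_signs x \<notin> set vs" by (auto simp: vs_def)
  have lvs: "length vs = 2 * k"
  proof -
    have "card (set vs) = card (set (rows G) - {x, alternate_signs x})"
      by (rule arg_cong[of _ _ card]) (auto simp: vs_def)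
    also have "\<dots> = card (set (rows G)) - card {x, alternate_signs x}"
      by (rule card_Diff_subset) (use assms(7,8) in auto)
    also have "\<dots> = n - 2" using ne distinct_card[OF distinct_rows[OF G]] Gc by simp
    finally show ?thesis using distinct_card[OF dvs] nk by simp
  qed

  \<comment> \<open>Shape and entries of the combined matrix\<close>
  let ?top = "Psi_top n G x" and ?bot = "Psi_bottom n Xs x T" and ?P = "Psi n Xs G x T"
  define N where "N = k * n"
  have N: "N = Suc k * (2 * k)" "N = 2 * k + k * (2 * k)" by (auto simp: N_def n)
  have top: "?top \<in> carrier_mat (2 * k) N"
    using Gc lvs by (auto simp: Psi_top_def delete_pair_def vs_def[symmetric] kronecker_def ones_row_def nk N_def mult.commute)
  have bot: "?bot \<in> carrier_mat (k * (2 * k)) N"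
  proof -
    have "n div 2 = Suc k" using n by simp
    then show ?thesis unfolding N(1) by (simp add: Psi_bottom_def uniform_block_mat_def nk)
  qed
  have Pc: "?P \<in> carrier_mat N N"
    using carrier_append_rows[OF top bot] by (simp add: Psi_def N(2))
  have cbound: "b * (2 * k) + j < N" if "b < Suc k" "j < 2 * k" for b j
  proof -
    have "Suc b * (2 * k) \<le> Suc k * (2 * k)" using that by (intro mult_le_mono1) auto
    then show ?thesis using that(2) unfolding N(1) mult_Suc by linarith
  qed
  have top_idx: "?top $$ (r, c) = vs ! r $ (c div k)" if "r < 2 * k" "c < N" for r c
  proof -
    have "c div k < n" using that(2) by (simp add: N_def less_mult_imp_div_less mult.commute)
    then show ?thesis
      using that lvs Gc k unfolding Psi_top_def kronecker_def delete_pair_def vs_def[symmetric]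
      by (auto simp: ones_row_def nk N_def mult.commute mat_of_rows_index)
  qed
  \<comment> \<open>Repeating each entry \<open>k\<close> times aligns the two parts: in any column
    the top entry and the scalar of the bottom entry have the same index
    \<open>2 * b + j div k\<close>.\<close>
  have Ptop: "?P $$ (r, b * (2 * k) + j) = vs ! r $ (2 * b + j div k)"
    if "r < 2 * k" "b < Suc k" "j < 2 * k" for r b j
  proof -
    have c: "b * (2 * k) + j < N" using cbound that by blast
    have e: "(b * (2 * k) + j) div k = 2 * b + j div k"
      using k by (metis div_mult_self3 mult.assoc mult.commute neq0_conv)
    have "?P $$ (r, b * (2 * k) + j) = ?top $$ (r, b * (2 * k) + j)"
      unfolding Psi_def using append_rows_index[OF top bot _ c] that by simp
    also have "\<dots> = vs ! r $ (2 * b + j div k)"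
      using top_idx[OF that(1) c] by (simp only: e)
    finally show ?thesis .
  qed
  have Pbot: "?P $$ (2 * k + (s * (2 * k) + (h * k + i)), b * (2 * k) + j) =
      x $ (2 * b + j div k) * T $$ (h * k + block_symbol L s i b, j)"
    if "s < k" "h < 2" "i < k" "b < Suc k" "j < 2 * k" for s h i b j
  proof -
    have c: "b * (2 * k) + j < N" using cbound that by blast
    have "Suc s * (2 * k) \<le> k * (2 * k)" using that by (intro mult_le_mono1) auto
    moreover have "h * k + i < 2 * k" using that by (cases h) auto
    ultimately have r: "s * (2 * k) + (h * k + i) < k * (2 * k)" unfolding mult_Suc by linarith
    show ?thesis
      unfolding Psi_def using append_rows_index[OF top bot _ c] r
        Psi_bottom_index[where L = L and Xs = Xs, OF n T(1) lat Xs, of s h i b j x] that by simp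
  qed

  have bidx: "h * k + block_symbol L s i b < 2 * k" if "s < k" "h < 2" "i < k" "b < Suc k" for s h i b
    using block_symbol_less[where L = L, OF lat that(1,3,4)] that(2) by (cases h) auto
  have xbound: "2 * b + j div k < n" if "b < Suc k" "j < 2 * k" for b j
  proof -
    have "j div k < 2" using that by (simp add: less_mult_imp_div_less)
    then show ?thesis using that n by auto
  qed
  \<comment> \<open>Bottom rows are read in mixed radix: block row \<open>s\<close>, half
    \<open>h\<close>, position \<open>i\<close> inside the half.\<close>
  have rowcases: "r < 2 * k \<or> (\<exists>s h i. s < k \<and> h < 2 \<and> i < k \<and> r = 2 * k + (s * (2 * k) + (h * k + i)))"
    if "r < N" for r
  proof (cases "r < 2 * k")
    case False
    define q where "q = r - 2 * k"
    have q: "q < k * (2 * k)" "r = 2 * k + q" using False that N(2) by (auto simp: q_def)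
    have "q div (2 * k) < k" using q by (simp add: less_mult_imp_div_less)
    moreover have "q mod (2 * k) div k < 2"
      using k by (intro less_mult_imp_div_less) simp
    moreover have "q mod (2 * k) mod k < k" using k by simp
    moreover have "q = q div (2 * k) * (2 * k) + (q mod (2 * k) div k * k + q mod (2 * k) mod k)"
      by (simp only: div_mult_mod_eq)
    ultimately show ?thesis
      unfolding q(2)
      by (intro disjI2 exI[of _ "q div (2 * k)"] exI[of _ "q mod (2 * k) div k"]
          exI[of _ "q mod (2 * k) mod k"] conjI arg_cong[where f = "(+) (2 * k)"])
  qed simp

  \<comment> \<open>Inner products of rows\<close>
  define ip where "ip r r' = (\<Sum>c<N. ?P $$ (r, c) * cnj (?P $$ (r', c)))" for r r'
  have ip: "ip r r' = (\<Sum>b<Suc k. \<Sum>j<2 * k. ?P $$ (r, b * (2 * k) + j) * cnj (?P $$ (r', b * (2 * k) + j)))"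
    for r r' unfolding ip_def N(1) by (rule sum_over_blocks)
  \<comment> \<open>Spares a separate computation for a bottom row against a top row.\<close>
  have ip_sym: "ip r r' = cnj (ip r' r)" for r r' by (simp add: ip_def mult.commute)
  have split: "(\<Sum>j<2 * k. u j) = (\<Sum>j<k. u j) + (\<Sum>j<k. u (k + j))" for u :: "nat \<Rightarrow> complex"
    using sum_over_blocks[of u 2 k] by (simp add: numeral_2_eq_2)
  have pairs: "(\<Sum>c<n. u c) = (\<Sum>b<Suc k. u (2 * b) + u (2 * b + 1))" for u :: "nat \<Rightarrow> complex"
    using sum_over_blocks[of u "Suc k" 2] by (simp add: n numeral_2_eq_2 mult.commute del: sum.lessThan_Suc)
      (simp add: numeral_2_eq_2)

  have tt: "ip r r' = (if r = r' then of_nat N else 0)" if "r < 2 * k" "r' < 2 * k" for r r'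
  proof -
    let ?v = "vs ! r" and ?w = "vs ! r'"
    have vw: "?v \<in> set (rows G)" "?w \<in> set (rows G)" using that lvs vsG(1) by (auto simp: subset_iff)
    have "ip r r' = (\<Sum>b<Suc k. \<Sum>j<2 * k. ?v $ (2 * b + j div k) * cnj (?w $ (2 * b + j div k)))"
      unfolding ip using that by (intro sum.cong refl) (simp add: Ptop)
    also have "\<dots> = (\<Sum>b<Suc k. of_nat k * (?v $ (2 * b) * cnj (?w $ (2 * b)) + ?v $ (2 * b + 1) * cnj (?w $ (2 * b + 1))))"
      unfolding split using k by (intro sum.cong refl) (simp add: distrib_left)
    also have "\<dots> = of_nat k * (\<Sum>c<n. ?v $ c * cnj (?w $ c))"
      unfolding pairs sum_distrib_left[symmetric] ..
    also have "\<dots> = of_nat k * (if r = r' then of_nat n else 0)"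
      using rows_orthogonal[OF G vw] nth_eq_iff_index_eq[OF dvs] that lvs by simp
    finally show ?thesis by (simp add: N_def)
  qed

  have tb: "ip r (2 * k + (s * (2 * k) + (h * k + i))) = 0"
    if r: "r < 2 * k" and shi: "s < k" "h < 2" "i < k" for r s h i
  proof -
    let ?v = "vs ! r" and ?e = "if h = 0 then 1 else -1 :: complex"
    have "?v \<in> set vs" using r lvs by simp
    then have v: "?v \<in> set (rows G)" "?v \<noteq> x" "?v \<noteq> alternate_signs x"
      by (simp_all add: vs_def)
    have T4: "(\<Sum>j<k. cnj (T $$ (p, j))) = -1" "(\<Sum>j<k. cnj (T $$ (p, k + j))) = - half_sign k p"
      if "p < 2 * k" for p
    proof -
      show "(\<Sum>j<k. cnj (T $$ (p, j))) = -1"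
        using arg_cong[OF T(4)[OF that], of cnj] by simp
      show "(\<Sum>j<k. cnj (T $$ (p, k + j))) = - half_sign k p"
        using arg_cong[OF T(5)[OF that], of cnj] by (simp add: half_sign_def split: if_splits)
    qed
    \<comment> \<open>Blocks move rows of \<open>T\<close> only within a half, so the sign depends
      on \<open>h\<close> alone and is the same in all block columns.\<close>
    have sg: "half_sign k (h * k + block_symbol L s i b) = ?e" if "b < Suc k" for b
      using block_symbol_less[where L = L, OF lat shi(1,3) that] shi(2) by (cases h) (auto simp: half_sign_def)
    have "ip r (2 * k + (s * (2 * k) + (h * k + i))) =
      (\<Sum>b<Suc k. \<Sum>j<2 * k. (?v $ (2 * b + j div k) * cnj (x $ (2 * b + j div k))) *
         cnj (T $$ (h * k + block_symbol L s i b, j)))"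
      unfolding ip using r shi by (intro sum.cong refl) (simp add: Ptop Pbot)
    also have "\<dots> = (\<Sum>b<Suc k. ?v $ (2 * b) * cnj (x $ (2 * b)) * (\<Sum>j<k. cnj (T $$ (h * k + block_symbol L s i b, j)))
        + ?v $ (2 * b + 1) * cnj (x $ (2 * b + 1)) * (\<Sum>j<k. cnj (T $$ (h * k + block_symbol L s i b, k + j))))"
      unfolding split sum_distrib_left using k by (intro sum.cong refl arg_cong2[of _ _ _ _ "(+)"]) simp_all
    also have "\<dots> = (\<Sum>b<Suc k. - (?v $ (2 * b) * cnj (x $ (2 * b)) + ?e * (?v $ (2 * b + 1) * cnj (x $ (2 * b + 1)))))"
      using shi by (intro sum.cong refl) (simp add: T4 bidx sg del: One_nat_def)
    \<comment> \<open>Entries at even indices have weight -1 and those at odd indices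
      \<open>-?e\<close>. Thus \<open>h = 0\<close> yields \<open>x\<close> and \<open>h = 1\<close>
      its alternation, and neither equals \<open>?v\<close>.\<close>
    also have "\<dots> = - (\<Sum>c<n. ?v $ c * cnj ((if h = 0 then x else alternate_signs x) $ c))"
      unfolding pairs sum_negf[symmetric]
      using n by (intro sum.cong refl) (auto simp: alt)
    also have "\<dots> = 0"
      using rows_orthogonal[OF G v(1) assms(7)] rows_orthogonal[OF G v(1) assms(8)] v(2,3) by auto
    finally show ?thesis .
  qed

  have bb: "ip (2 * k + (s * (2 * k) + (h * k + i))) (2 * k + (s' * (2 * k) + (h' * k + i')))
      = (if s = s' \<and> h = h' \<and> i = i' then of_nat N else 0)"
    if shi: "s < k" "h < 2" "i < k" and shi': "s' < k" "h' < 2" "i' < k" for s h i s' h' i'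
  proof -
    let ?f = "block_symbol L s i" and ?g = "block_symbol L s' i'"
    have uni: "x $ c * cnj (x $ c) = 1" if "c < n" for c
      by (rule root_of_unity_mult_cnj[OF root[OF assms(7) that] assms(2)])
    have "ip (2 * k + (s * (2 * k) + (h * k + i))) (2 * k + (s' * (2 * k) + (h' * k + i'))) =
      (\<Sum>b<Suc k. \<Sum>j<2 * k. (x $ (2 * b + j div k) * cnj (x $ (2 * b + j div k))) *
         (T $$ (h * k + ?f b, j) * cnj (T $$ (h' * k + ?g b, j))))"
      unfolding ip using shi shi' by (intro sum.cong refl) (simp add: Pbot)
    \<comment> \<open>Both rows carry the same scalar of modulus 1 in each column, so it
      cancels.\<close>
    also have "\<dots> = (\<Sum>b<Suc k. \<Sum>j<2 * k. T $$ (h * k + ?f b, j) * cnj (T $$ (h' * k + ?g b, j)))"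
      by (intro sum.cong refl) (simp add: uni xbound)
    \<comment> \<open>The correction for the deleted columns is -2 within one half and 0 across
      halves, where moreover the two rows of \<open>T\<close> always differ.\<close>
    also have "\<dots> = (\<Sum>b<Suc k. if h = h' then (if ?f b = ?g b then of_nat n else 0) - 2 else 0)"
    proof (intro sum.cong refl)
      fix b assume "b \<in> {..<Suc k}"
      then have b: "b < Suc k" by simp
      have fg: "?f b < k" "?g b < k" using block_symbol_less[where L = L, OF lat _ _ b] shi shi' by auto
      have "h = 0 \<or> h = 1" "h' = 0 \<or> h' = 1" using shi shi' by auto
      then show "(\<Sum>j<2 * k. T $$ (h * k + ?f b, j) * cnj (T $$ (h' * k + ?g b, j))) =
          (if h = h' then (if ?f b = ?g b then of_nat n else 0) - 2 else 0)"
        using fg by (subst T(3)) (auto simp: bidx shi shi' b half_sign_def)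
    qed
    also have "\<dots> = (if s = s' \<and> h = h' \<and> i = i' then of_nat N else 0)"
    proof (cases "h = h'")
      case True
      \<comment> \<open>With \<open>a\<close> agreements the total is \<open>a * n - n\<close>: this
        is \<open>N\<close> for \<open>a = Suc k\<close> and 0 for \<open>a = 1\<close>.\<close>
      have "(\<Sum>b<Suc k. if ?f b = ?g b then of_nat n else 0 :: complex)
          = of_nat (card {b. b < Suc k \<and> ?f b = ?g b}) * of_nat n"
        by (subst sum.inter_filter[symmetric]) auto
      also have "card {b. b < Suc k \<and> ?f b = ?g b} = (if s = s' \<and> i = i' then Suc k else 1)"
        by (rule card_block_symbol_agree[where L = L, OF lat lsesc]) (use shi shi' in auto)
      finally show ?thesis
        using True by (simp add: sum_subtractf N_def n algebra_simps del: sum.lessThan_Suc)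
    qed simp
    finally show ?thesis .
  qed

  have "ip r r' = (if r = r' then of_nat N else 0)" if rr: "r < N" "r' < N" for r r'
    using rowcases[OF rr(1)]
  proof (elim disjE exE conjE)
    assume r: "r < 2 * k"
    from rowcases[OF rr(2)] show ?thesis
    proof (elim disjE exE conjE)
      assume "r' < 2 * k" then show ?thesis using r tt by simp
    next
      fix s h i assume a: "s < k" "h < 2" "i < k" "r' = 2 * k + (s * (2 * k) + (h * k + i))"
      then show ?thesis using tb[OF r a(1-3)] r by auto
    qed
  next
    fix s h i assume a: "s < k" "h < 2" "i < k" "r = 2 * k + (s * (2 * k) + (h * k + i))"
    from rowcases[OF rr(2)] show ?thesis
    proof (elim disjE exE conjE)
      assume r': "r' < 2 * k"
      then show ?thesis using tb[OF r' a(1-3)] ip_sym[of r r'] a(4) by auto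
    next
      fix s' h' i' assume a': "s' < k" "h' < 2" "i' < k" "r' = 2 * k + (s' * (2 * k) + (h' * k + i'))"
      \<comment> \<open>\<open>bb\<close> compares coordinates whereas the goal compares row
        indices; quotients and remainders recover the former from the latter.\<close>
      have "s = s' \<and> h = h' \<and> i = i'" if "r = r'"
      proof -
        have lt: "h * k + i < 2 * k" "h' * k + i' < 2 * k" using a a' by (cases h; cases h'; auto)+
        have e: "s * (2 * k) + (h * k + i) = s' * (2 * k) + (h' * k + i')" using that a(4) a'(4) by simp
        have "s = s'" using arg_cong[OF e, of "\<lambda>z. z div (2 * k)"] lt k by simp
        moreover have e2: "h * k + i = h' * k + i'" using arg_cong[OF e, of "\<lambda>z. z mod (2 * k)"] lt by simp
        moreover have "h = h'" using arg_cong[OF e2, of "\<lambda>z. z div k"] a a' by simp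
        ultimately show ?thesis by simp
      qed
      then show ?thesis using bb[OF a(1-3) a'(1-3)] a(4) a'(4) by auto
    qed
  qed

  \<comment> \<open>Entries as roots of unity\<close>
  moreover have "?P $$ (r, c) ^ m = 1" if rc: "r < N" "c < N" for r c
  proof -
    define b j where "b = c div (2 * k)" and "j = c mod (2 * k)"
    have c: "c = b * (2 * k) + j" by (simp only: b_def j_def div_mult_mod_eq)
    have bj: "b < Suc k" "j < 2 * k"
      using rc(2) k by (auto simp: b_def j_def N(1) intro!: less_mult_imp_div_less simp del: mult_Suc)
    from rowcases[OF rc(1)] show ?thesis
    proof (elim disjE exE conjE)
      assume r: "r < 2 * k"
      then have "vs ! r \<in> set (rows G)" using lvs vsG(1) by (auto simp: subset_iff)
      then show ?thesis using Ptop[OF r bj] root xbound bj by (simp add: c)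
    next
      fix s h i assume a: "s < k" "h < 2" "i < k" "r = 2 * k + (s * (2 * k) + (h * k + i))"
      show ?thesis
        using Pbot[OF a(1-3) bj] root[OF assms(7) xbound[OF bj]] T(2)[OF bidx[OF a(1-3) bj(1)] bj(2)]
        by (simp add: a(4) c power_mult_distrib)
    qed
  qed
  ultimately show ?thesis using Pc by (simp add: BH_iff nk N_def[symmetric] ip_def)
qed

end
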